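(* Let $c \ge 2$ be an integer. If $G$ is a (finite, simple) graph with $\mathrm{mad}(G) < 4 - \frac{1}{c}$ and $\Delta(G) \ge 14c - 7$, then $\chi_\ell(G^2) \le 2\Delta(G)$.
   Context: For a graph $G$, $\Delta(G)$ is its maximum degree. The square $G^2$ of $G$ is the graph on $V(G)$ in which two distinct vertices are adjacent iff their distance in $G$ is at most $2$. The maximum average degree $\mathrm{mad}(G)$ is the maximum, over all subgraphs $H$ of $G$ with $V(H)\neq\emptyset$, of the average degree $2|E(H)|/|V(H)|$. The list chromatic number $\chi_\ell(G)$ is the least $k$ such that for every assignment of lists $L(v)$ with $|L(v)|\ge k$ to the vertices, there is a proper coloring $\phi$ of $G$ with $\phi(v)\in L(v)$ for all $v$. *)

theory Defs
  imports Complex_Main "HOL-Library.Extended_Nat"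
begin

record 'a graph =
  verts :: "'a set"
  edges :: "'a set set"

definition finite_simple_graph :: "'a graph \<Rightarrow> bool" where
  "finite_simple_graph G \<longleftrightarrow>
     finite (verts G) \<and> (\<forall>e\<in>edges G. e \<subseteq> verts G \<and> card e = 2)"

definition adjacent :: "'a graph \<Rightarrow> 'a \<Rightarrow> 'a \<Rightarrow> bool" where
  "adjacent G u v \<longleftrightarrow> {u, v} \<in> edges G"

definition degree :: "'a graph \<Rightarrow> 'a \<Rightarrow> nat" where
  "degree G v = card {e \<in> edges G. v \<in> e}"

(* The inserted 0 only matters for the graph without vertices. *)
definition max_degree :: "'a graph \<Rightarrow> nat" where
  "max_degree G = Max (insert 0 (degree G ` verts G))"

definition path_between :: "'a graph \<Rightarrow> 'a \<Rightarrow> 'a list \<Rightarrow> 'a \<Rightarrow> bool" where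
  "path_between G u p v \<longleftrightarrow>
     p \<noteq> [] \<and> hd p = u \<and> last p = v \<and>
     set p \<subseteq> verts G \<and> distinct p \<and> successively (adjacent G) p"

(* A path is the list of its vertices, so it has length p - 1 edges;
   the infimum of the empty set is infinity. *)
definition distance :: "'a graph \<Rightarrow> 'a \<Rightarrow> 'a \<Rightarrow> enat" where
  "distance G u v = Inf {enat (length p - 1) | p. path_between G u p v}"

definition square :: "'a graph \<Rightarrow> 'a graph" where
  "square G = \<lparr> verts = verts G,
     edges = {{u, v} | u v. u \<in> verts G \<and> v \<in> verts G \<and> u \<noteq> v \<and> distance G u v \<le> 2} \<rparr>"

definition subgraph :: "'a graph \<Rightarrow> 'a graph \<Rightarrow> bool" where
  "subgraph H G \<longleftrightarrow>
     finite_simple_graph H \<and> verts H \<subseteq> verts G \<and> edges H \<subseteq> edges G"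

definition average_degree :: "'a graph \<Rightarrow> real" where
  "average_degree G = 2 * real (card (edges G)) / real (card (verts G))"

(* Unspecified for the graph without vertices. *)
definition mad :: "'a graph \<Rightarrow> real" where
  "mad G = Max {average_degree H | H. subgraph H G \<and> verts H \<noteq> {}}"

definition proper_coloring :: "'a graph \<Rightarrow> ('a \<Rightarrow> 'c) \<Rightarrow> bool" where
  "proper_coloring G \<phi> \<longleftrightarrow>
     (\<forall>u\<in>verts G. \<forall>v\<in>verts G. adjacent G u v \<longrightarrow> \<phi> u \<noteq> \<phi> v)"

(* Lists are finite sets of natural numbers. For a finite graph this is no restriction:
   an infinite list may be cut down to a finite one, and then only finitely many
   colors occur. *)
definition choosable :: "'a graph \<Rightarrow> nat \<Rightarrow> bool" where
  "choosable G k \<longleftrightarrow>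
     (\<forall>L :: 'a \<Rightarrow> nat set.
        (\<forall>v\<in>verts G. finite (L v) \<and> k \<le> card (L v)) \<longrightarrow>
        (\<exists>\<phi>. proper_coloring G \<phi> \<and> (\<forall>v\<in>verts G. \<phi> v \<in> L v)))"

definition list_chromatic_number :: "'a graph \<Rightarrow> nat" where
  "list_chromatic_number G = (LEAST k. choosable G k)"

end

theory Submission
  imports Defs
begin

text \<open>Write \<open>\<Delta>\<close> for the maximum degree and call a vertex weak if the degrees of its neighbours
  sum to less than \<open>2\<Delta>\<close>; a weak vertex has fewer than \<open>2\<Delta>\<close> neighbours in the square, so it can
  be colored last. In a minimal counterexample all degrees are at least 2, and a weak
  vertex \<open>v\<close> has no neighbour \<open>u\<close> whose neighbour degrees sum to at most \<open>2\<Delta>\<close>: otherwise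
  delete the edge \<open>uv\<close>, color, and recolor first \<open>u\<close>, then \<open>v\<close>.
  Now give every vertex \<open>v\<close> the charge \<open>4c d(v) - (16c - 4)\<close>. A vertex of degree at least
  \<open>8c - 2\<close> sends \<open>4c - 2\<close> to each neighbour; every other vertex that is not weak sends
  \<open>4c - d(v)\<close> to each weak neighbour \<open>v\<close> with \<open>d(v) \<le> 3\<close>. All final charges are nonnegative,
  so the average degree is at least \<open>4 - 1/c\<close>.\<close>

section \<open>Neighbourhoods in a graph and in its square\<close>

definition nbrs :: "'a graph \<Rightarrow> 'a \<Rightarrow> 'a set" where
  "nbrs G v = {u. adjacent G v u}"

text \<open>The neighbourhood in the square, phrased by adjacency alone; paths and distances enter
  only in \<open>square_adjacent_imp_sq_nbrs\<close>.\<close>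

definition sq_nbrs :: "'a graph \<Rightarrow> 'a \<Rightarrow> 'a set" where
  "sq_nbrs G v = {u. u \<noteq> v \<and> (adjacent G v u \<or> (\<exists>w. adjacent G v w \<and> adjacent G w u))}"

definition nbr_degree_sum :: "'a graph \<Rightarrow> 'a \<Rightarrow> nat" where
  "nbr_degree_sum G v = (\<Sum>u\<in>nbrs G v. degree G u)"

lemma adjacent_commute: "adjacent G u v \<longleftrightarrow> adjacent G v u"
  by (simp add: adjacent_def insert_commute)

lemma in_nbrs_commute: "u \<in> nbrs G v \<longleftrightarrow> v \<in> nbrs G u"
  using adjacent_commute unfolding nbrs_def by fast

lemma sq_nbrs_commute: "u \<in> sq_nbrs G v \<longleftrightarrow> v \<in> sq_nbrs G u"
  using adjacent_commute unfolding sq_nbrs_def by fast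

lemma adjacentD:
  assumes "finite_simple_graph G" "adjacent G u v"
  shows "u \<in> verts G" "v \<in> verts G" "u \<noteq> v"
proof -
  have "{u, v} \<subseteq> verts G" "card {u, v} = 2"
    using assms unfolding finite_simple_graph_def adjacent_def by blast+
  then show "u \<in> verts G" "v \<in> verts G" "u \<noteq> v"
    by auto
qed

lemma nbrs_subset: "finite_simple_graph G \<Longrightarrow> nbrs G v \<subseteq> verts G"
  by (auto simp: nbrs_def dest: adjacentD)

lemma finite_nbrs: "finite_simple_graph G \<Longrightarrow> finite (nbrs G v)"
  by (metis finite_subset nbrs_subset finite_simple_graph_def)

lemma sq_nbrs_subset: "finite_simple_graph G \<Longrightarrow> sq_nbrs G v \<subseteq> verts G"
  by (auto simp: sq_nbrs_def dest: adjacentD)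

lemma finite_sq_nbrs: "finite_simple_graph G \<Longrightarrow> finite (sq_nbrs G v)"
  by (metis finite_subset sq_nbrs_subset finite_simple_graph_def)

lemma finite_edges: "finite_simple_graph G \<Longrightarrow> finite (edges G)"
  by (rule finite_subset[of _ "Pow (verts G)"]) (auto simp: finite_simple_graph_def)

lemma card_nbrs:
  assumes "finite_simple_graph G"
  shows "card (nbrs G v) = degree G v"
proof -
  have "{e \<in> edges G. v \<in> e} = (\<lambda>u. {v, u}) ` nbrs G v"
  proof (intro equalityI subsetI)
    fix e assume "e \<in> {e \<in> edges G. v \<in> e}"
    then obtain x y where "e = {x, y}" "e \<in> edges G" "v \<in> e"
      using assms unfolding finite_simple_graph_def by (fastforce simp: card_2_iff)
    then show "e \<in> (\<lambda>u. {v, u}) ` nbrs G v"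
      by (auto simp: nbrs_def adjacent_def insert_commute)
  qed (auto simp: nbrs_def adjacent_def)
  moreover have "inj_on (\<lambda>u. {v, u}) (nbrs G v)"
    by (auto simp: inj_on_def doubleton_eq_iff)
  ultimately show ?thesis
    by (simp add: degree_def card_image)
qed

text \<open>A neighbour \<open>w\<close> of \<open>v\<close> accounts for itself and for its
  neighbours other than \<open>v\<close>, at most 1 + (d(w) - 1) vertices.\<close>

lemma card_sq_nbrs_le:
  assumes G: "finite_simple_graph G"
  shows "card (sq_nbrs G v) \<le> nbr_degree_sum G v"
proof -
  let ?B = "\<lambda>w. insert w (nbrs G w - {v})"
  have "sq_nbrs G v \<subseteq> (\<Union>w\<in>nbrs G v. ?B w)"
    by (auto simp: sq_nbrs_def nbrs_def)
  then have "card (sq_nbrs G v) \<le> card (\<Union>w\<in>nbrs G v. ?B w)"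
    by (intro card_mono) (auto simp: finite_nbrs G)
  also have "\<dots> \<le> (\<Sum>w\<in>nbrs G v. card (?B w))"
    by (rule card_UN_le) (simp add: finite_nbrs G)
  also have "\<dots> \<le> (\<Sum>w\<in>nbrs G v. degree G w)"
  proof (rule sum_mono)
    fix w assume "w \<in> nbrs G v"
    then have "v \<in> nbrs G w"
      by (simp add: in_nbrs_commute)
    then have "card (nbrs G w) = Suc (card (nbrs G w - {v}))"
      by (rule card.remove[OF finite_nbrs[OF G]])
    then show "card (?B w) \<le> degree G w"
      using card_insert_le_m1[of "degree G w" "nbrs G w - {v}" w] card_nbrs[OF G, of w] by simp
  qed
  finally show ?thesis
    by (simp add: nbr_degree_sum_def)
qed

lemma sum_degree:
  assumes "finite_simple_graph G"
  shows "(\<Sum>v\<in>verts G. degree G v) = 2 * card (edges G)"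
proof -
  have fin: "finite (verts G)" "finite (edges G)"
    using assms finite_edges by (auto simp: finite_simple_graph_def)
  have "(\<Sum>v\<in>verts G. degree G v) = (\<Sum>v\<in>verts G. \<Sum>e\<in>{e \<in> edges G. v \<in> e}. 1)"
    by (simp add: degree_def)
  also have "\<dots> = (\<Sum>e\<in>edges G. \<Sum>v\<in>{v \<in> verts G. v \<in> e}. 1)"
    by (rule sum.swap_restrict) (use fin in auto)
  also have "\<dots> = (\<Sum>e\<in>edges G. 2)"
  proof (rule sum.cong[OF refl])
    fix e assume "e \<in> edges G"
    then have "e \<subseteq> verts G" "card e = 2"
      using assms by (auto simp: finite_simple_graph_def)
    moreover from this have "{v \<in> verts G. v \<in> e} = e"
      by auto
    ultimately show "(\<Sum>v\<in>{v \<in> verts G. v \<in> e}. 1) = (2::nat)"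
      by simp
  qed
  finally show ?thesis
    by simp
qed

lemma subgraph_trans: "subgraph H G \<Longrightarrow> subgraph G K \<Longrightarrow> subgraph H K"
  by (auto simp: subgraph_def)

lemma degree_subgraph_le:
  assumes "subgraph H G" "finite_simple_graph G"
  shows "degree H v \<le> degree G v"
  unfolding degree_def using assms finite_edges[of G]
  by (intro card_mono) (auto simp: subgraph_def)

section \<open>Reducible configurations\<close>

text \<open>A partial coloring, but the constraints come from the square of all of \<open>G\<close>:
  two vertices of \<open>S\<close> with a common neighbour outside \<open>S\<close> must still
  differ.\<close>

definition sq_colors :: "'a graph \<Rightarrow> ('a \<Rightarrow> 'c set) \<Rightarrow> 'a set \<Rightarrow> ('a \<Rightarrow> 'c) \<Rightarrow> bool" where
  "sq_colors G L S \<phi> \<longleftrightarrow>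
     (\<forall>v\<in>S. \<phi> v \<in> L v) \<and> (\<forall>u\<in>S. \<forall>v\<in>S. v \<in> sq_nbrs G u \<longrightarrow> \<phi> u \<noteq> \<phi> v)"

text \<open>Greedy step: the colored square neighbours of \<open>v\<close> cannot use up its
  list.\<close>

lemma sq_colors_insert:
  assumes col: "sq_colors G L S \<phi>" and "v \<notin> S"
    and fin: "finite (sq_nbrs G v \<inter> S)" and "card (sq_nbrs G v \<inter> S) < card (L v)"
  shows "\<exists>\<psi>. sq_colors G L (insert v S) \<psi>"
proof -
  have "card (\<phi> ` (sq_nbrs G v \<inter> S)) < card (L v)"
    using card_image_le[OF fin, of \<phi>] assms(4) by linarith
  then have "\<not> L v \<subseteq> \<phi> ` (sq_nbrs G v \<inter> S)"
    using card_mono[of "\<phi> ` (sq_nbrs G v \<inter> S)" "L v"] fin by auto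
  then obtain a where a: "a \<in> L v" "a \<notin> \<phi> ` (sq_nbrs G v \<inter> S)"
    by blast
  have "v \<notin> sq_nbrs G v"
    by (simp add: sq_nbrs_def)
  moreover have "x \<in> sq_nbrs G v" if "v \<in> sq_nbrs G x" for x
    using that sq_nbrs_commute by fast
  ultimately have "sq_colors G L (insert v S) (\<phi>(v := a))"
    using col a \<open>v \<notin> S\<close> unfolding sq_colors_def by auto
  then show ?thesis
    by blast
qed

lemma sq_colors_transfer:
  assumes "sq_colors H L (verts H) \<phi>" "S \<subseteq> verts H"
    and "\<And>x y. x \<in> S \<Longrightarrow> y \<in> S \<Longrightarrow> y \<in> sq_nbrs G x \<Longrightarrow> y \<in> sq_nbrs H x"
  shows "sq_colors G L S \<phi>"
  using assms unfolding sq_colors_def by (meson subsetD)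

section \<open>Deleting a vertex or an edge\<close>

definition delete_vertex :: "'a graph \<Rightarrow> 'a \<Rightarrow> 'a graph" where
  "delete_vertex G v = \<lparr>verts = verts G - {v}, edges = {e \<in> edges G. v \<notin> e}\<rparr>"

definition delete_edge :: "'a graph \<Rightarrow> 'a set \<Rightarrow> 'a graph" where
  "delete_edge G e = \<lparr>verts = verts G, edges = edges G - {e}\<rparr>"

lemma subgraph_delete_vertex:
  "finite_simple_graph G \<Longrightarrow> subgraph (delete_vertex G v) G"
  by (auto simp: subgraph_def delete_vertex_def finite_simple_graph_def)

lemma subgraph_delete_edge:
  "finite_simple_graph G \<Longrightarrow> subgraph (delete_edge G e) G"
  by (auto simp: subgraph_def delete_edge_def finite_simple_graph_def)

text \<open>A vertex with at most one neighbour is never the middle of a path between two others, so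
  its deletion preserves square adjacency among the rest.\<close>

lemma sq_colors_extend_pendant:
  assumes G: "finite_simple_graph G" and v: "v \<in> verts G" and "degree G v \<le> 1"
    and lists: "nbr_degree_sum G v < card (L v)"
    and col: "sq_colors (delete_vertex G v) L (verts (delete_vertex G v)) \<phi>"
  shows "\<exists>\<psi>. sq_colors G L (verts G) \<psi>"
proof -
  let ?H = "delete_vertex G v"
  have "card (nbrs G v) \<le> Suc 0"
    using \<open>degree G v \<le> 1\<close> by (simp add: card_nbrs[OF G])
  then have unique: "x = y" if "adjacent G v x" "adjacent G v y" for x y
    using that by (auto simp: card_le_Suc0_iff_eq[OF finite_nbrs[OF G]]) (auto simp: nbrs_def)
  have adj: "adjacent ?H x y" if "adjacent G x y" "x \<noteq> v" "y \<noteq> v" for x y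
    using that by (auto simp: adjacent_def delete_vertex_def)
  have "sq_colors G L (verts G - {v}) \<phi>"
  proof (rule sq_colors_transfer[OF col])
    fix x y assume xy: "x \<in> verts G - {v}" "y \<in> verts G - {v}" "y \<in> sq_nbrs G x"
    have "w \<noteq> v" if "adjacent G x w" "adjacent G w y" for w
      using that unique[of x y] xy adjacent_commute[of G] by (auto simp: sq_nbrs_def)
    then show "y \<in> sq_nbrs ?H x"
      using xy adj unfolding sq_nbrs_def by blast
  qed (auto simp: delete_vertex_def)
  moreover have "card (sq_nbrs G v \<inter> (verts G - {v})) \<le> card (sq_nbrs G v)"
    by (intro card_mono finite_sq_nbrs G) auto
  moreover note card_sq_nbrs_le[OF G, of v]
  ultimately have "\<exists>\<psi>. sq_colors G L (insert v (verts G - {v})) \<psi>"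
    using lists by (intro sq_colors_insert) (auto simp: finite_sq_nbrs G)
  then show ?thesis
    using v by (simp add: insert_absorb)
qed

text \<open>A path of length at most 2 whose ends avoid \<open>u\<close> and \<open>v\<close> does
  not use the edge \<open>uv\<close>, so the coloring survives outside these two vertices.\<close>

lemma sq_colors_extend_edge:
  assumes G: "finite_simple_graph G" and uv: "adjacent G u v"
    and u: "nbr_degree_sum G u \<le> card (L u)" and v: "nbr_degree_sum G v < card (L v)"
    and col: "sq_colors (delete_edge G {u, v}) L (verts (delete_edge G {u, v})) \<phi>"
  shows "\<exists>\<psi>. sq_colors G L (verts G) \<psi>"
proof -
  let ?H = "delete_edge G {u, v}"
  let ?S = "verts G - {u, v}"
  note uvD = adjacentD[OF G uv]
  have "sq_colors G L ?S \<phi>"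
  proof (rule sq_colors_transfer[OF col])
    fix x y assume xy: "x \<in> ?S" "y \<in> ?S" "y \<in> sq_nbrs G x"
    have "adjacent ?H x w \<longleftrightarrow> adjacent G x w" "adjacent ?H w y \<longleftrightarrow> adjacent G w y" for w
      using xy by (auto simp: adjacent_def delete_edge_def)
    then show "y \<in> sq_nbrs ?H x"
      using xy(3) by (simp add: sq_nbrs_def)
  qed (auto simp: delete_edge_def)
  \<comment> \<open>While \<open>u\<close> is recolored, its neighbour \<open>v\<close> is still
    uncolored. This saves one color, so the non-strict bound suffices for \<open>u\<close>.\<close>
  moreover have "card (sq_nbrs G u \<inter> ?S) < card (sq_nbrs G u)"
  proof (intro psubset_card_mono finite_sq_nbrs G)
    have "v \<in> sq_nbrs G u"
      using uv uvD by (auto simp: sq_nbrs_def)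
    then show "sq_nbrs G u \<inter> ?S \<subset> sq_nbrs G u"
      by auto
  qed
  moreover note card_sq_nbrs_le[OF G, of u]
  ultimately have "\<exists>\<psi>. sq_colors G L (insert u ?S) \<psi>"
    using u by (intro sq_colors_insert) (auto simp: finite_sq_nbrs G)
  then obtain \<psi> where "sq_colors G L (insert u ?S) \<psi>" ..
  moreover have "card (sq_nbrs G v \<inter> insert u ?S) \<le> card (sq_nbrs G v)"
    by (intro card_mono finite_sq_nbrs G) auto
  moreover note card_sq_nbrs_le[OF G, of v]
  ultimately have "\<exists>\<psi>. sq_colors G L (insert v (insert u ?S)) \<psi>"
    using v uvD by (intro sq_colors_insert) (auto simp: finite_sq_nbrs G)
  moreover have "insert v (insert u ?S) = verts G"
    using uvD by auto
  ultimately show ?thesis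
    by simp
qed

section \<open>Discharging\<close>

text \<open>Here \<open>h\<close> neighbours have degree at least \<open>8c - 2\<close>, the weak neighbours of degree at
  most 3 have degree sum \<open>S\<close>, and \<open>m\<close> neighbours are left.\<close>

lemma charge_arith:
  fixes c D h m S :: int
  assumes c: "c \<ge> 2" and D: "D \<ge> 14 * c - 7" and nn: "h \<ge> 0" "m \<ge> 0" "S \<ge> 0"
    and sum: "h * D + S + m * (8 * c - 3) \<ge> 2 * D"
    and strict: "S > 0 \<Longrightarrow> h * D + S + m * (8 * c - 3) \<ge> 2 * D + 1"
  shows "h * (8 * c - 2) + S + m * (4 * c) \<ge> 16 * c - 4"
proof -
  consider "h = 0" | "h = 1" | "h \<ge> 2"
    using nn by linarith
  then show ?thesis
  proof cases
    case 1
    \<comment> \<open>The case m = 3 is tight and dictates 14c - 7: here S \<ge> 2D - 3(8c - 3)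
      \<ge> 4c - 5 > 0, so \<open>strict\<close> applies and gives the required S \<ge> 4c -
      4.\<close>
    consider "m = 0" | "m = 1" | "m = 2" | "m = 3" | "m \<ge> 4"
      using nn by linarith
    then show ?thesis
    proof cases
      case 5
      then have "m * (4 * c) \<ge> 4 * (4 * c)"
        using c by (intro mult_right_mono) auto
      then show ?thesis
        unfolding 1 using nn by linarith
    qed (use 1 c D nn sum strict in \<open>cases "S > 0"; simp\<close>)+
  next
    case 2
    consider "m = 0" | "m = 1" | "m \<ge> 2"
      using nn by linarith
    then show ?thesis
    proof cases
      case 3
      then have "m * (4 * c) \<ge> 2 * (4 * c)"
        using c by (intro mult_right_mono) auto
      moreover have "h * (8 * c - 2) = 8 * c - 2"
        using 2 by simp
      ultimately show ?thesis
        using nn by linarith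
    qed (use 2 c D nn sum in simp_all)
  next
    case 3
    then have "h * (8 * c - 2) \<ge> 2 * (8 * c - 2)" "m * (4 * c) \<ge> 0"
      using c nn by (intro mult_right_mono mult_nonneg_nonneg; simp)+
    then have "h * (8 * c - 2) + S + m * (4 * c) \<ge> 2 * (8 * c - 2) + 0 + 0"
      using nn by (intro add_mono)
    then show ?thesis
      by simp
  qed
qed

text \<open>The conclusion is "average degree at least 4 - 1/c" with denominators cleared. Scaling
  charges by 4c keeps them integral.\<close>

lemma discharging:
  fixes G :: "'a graph" and c :: int and D :: nat
  assumes c: "c \<ge> 2" and D: "int D \<ge> 14 * c - 7"
    and G: "finite_simple_graph G"
    and max: "\<And>v. v \<in> verts G \<Longrightarrow> degree G v \<le> D"
    and min: "\<And>v. v \<in> verts G \<Longrightarrow> degree G v \<ge> 2"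
    and weak: "\<And>u v. adjacent G u v \<Longrightarrow> nbr_degree_sum G v < 2 * D \<Longrightarrow> nbr_degree_sum G u > 2 * D"
  shows "c * (2 * int (card (edges G))) \<ge> (4 * c - 1) * int (card (verts G))"
proof -
  define d where "d v = int (degree G v)" for v
  define big where "big v \<longleftrightarrow> d v \<ge> 8 * c - 2" for v
  \<comment> \<open>The weak vertices with negative initial charge: at degree 4 or more the charge
    is at least 4.\<close>
  define needy where "needy v \<longleftrightarrow> nbr_degree_sum G v < 2 * D \<and> d v \<le> 3" for v
  define f where "f u v = (if big u then 4 * c - 2
      else if nbr_degree_sum G u \<ge> 2 * D \<and> needy v then 4 * c - d v else 0)" for u v
  let ?N = "nbrs G" and ?V = "verts G"
  have finV: "finite ?V"
    using G by (simp add: finite_simple_graph_def)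
  have d2: "d v \<ge> 2" if "v \<in> ?V" for v
    using min[OF that] by (simp add: d_def)
  have card_N: "int (card (?N v)) = d v" for v
    by (simp add: d_def card_nbrs[OF G])
  have f_nonneg: "f u v \<ge> 0" for u v
    using c by (auto simp: f_def needy_def)
  have N_V: "u \<in> ?V" if "u \<in> ?N v" for u v
    using that nbrs_subset[OF G] by blast
  have needy_not_big: "\<not> big v" if "needy v" for v
    using that c by (auto simp: needy_def big_def)
  \<comment> \<open>The initial 4c d(v) is spread as 4c over each neighbour, so each summand is what
    \<open>v\<close> holds after the exchange with \<open>u\<close>.\<close>
  have final: "(\<Sum>u\<in>?N v. 4 * c + f u v - f v u) \<ge> 16 * c - 4" if v: "v \<in> ?V" for v
  proof (cases "big v")
    case True
    \<comment> \<open>A big vertex keeps at least 2 per neighbour, and 2 d(v) \<ge> 16c - 4 is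
      exactly the threshold in \<open>big\<close>.\<close>
    have "d v * (4 * c + 0 - (4 * c - 2)) = (\<Sum>u\<in>?N v. 4 * c + 0 - (4 * c - 2))"
      by (simp add: card_N)
    also have "\<dots> \<le> (\<Sum>u\<in>?N v. 4 * c + f u v - f v u)"
      using True by (intro sum_mono) (auto simp: f_def[of v] f_nonneg)
    finally show ?thesis
      using True by (simp add: big_def)
  next
    case not_big: False
    show ?thesis
    proof (cases "nbr_degree_sum G v < 2 * D")
      case True
      have fv: "f v u = 0" for u
        using True not_big by (simp add: f_def)
      show ?thesis
      proof (cases "needy v")
        case True
        \<comment> \<open>By \<open>weak\<close>, no neighbour of \<open>v\<close> is weak, so each
          sends 4c - d(v), or 4c - 2 if big, which is no less since d(v) \<ge> 2. For d(v) = 2 the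
          total is exactly 16c - 4.\<close>
        have "4 * c + f u v - f v u \<ge> 8 * c - d v" if u: "u \<in> ?N v" for u
        proof -
          have "adjacent G u v"
            using u by (simp add: nbrs_def adjacent_commute)
          then have "nbr_degree_sum G u > 2 * D"
            using weak \<open>nbr_degree_sum G v < 2 * D\<close> by blast
          then have "f u v \<ge> 4 * c - d v"
            using True d2[OF v] by (simp add: f_def)
          then show ?thesis
            by (simp add: fv)
        qed
        then have "(\<Sum>u\<in>?N v. 4 * c + f u v - f v u) \<ge> d v * (8 * c - d v)"
          using sum_mono[of "?N v" "\<lambda>u. 8 * c - d v"] by (simp add: card_N)
        moreover have "d v = 2 \<or> d v = 3"
          using True d2[OF v] by (auto simp: needy_def)
        ultimately show ?thesis
          using c by auto
      next
        case False
        have "(\<Sum>u\<in>?N v. 4 * c + f u v - f v u) \<ge> d v * (4 * c)"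
          using sum_mono[of "?N v" "\<lambda>u. 4 * c" "\<lambda>u. 4 * c + f u v - f v u"]
          by (simp add: card_N fv f_nonneg)
        moreover have "d v * (4 * c) \<ge> 4 * (4 * c)"
          using False True c by (intro mult_right_mono) (auto simp: needy_def)
        ultimately show ?thesis
          by linarith
      qed
    next
      case strong: False
      \<comment> \<open>Per neighbour \<open>u\<close> in the three classes, \<open>v\<close> ends
        with at least 8c - 2, d(u) and 4c, while the degree of \<open>u\<close> is at most D, d(u)
        and 8c - 3. \<open>charge_arith\<close> compares the two totals.\<close>
      let ?H = "{u \<in> ?N v. big u}" and ?S = "{u \<in> ?N v. needy u}"
        and ?M = "{u \<in> ?N v. \<not> big u \<and> \<not> needy u}"
      have split: "sum g (?N v) = sum g ?H + sum g ?S + sum g ?M" for g :: "'a \<Rightarrow> int"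
      proof -
        have "?N v = (?H \<union> ?S) \<union> ?M"
          by auto
        then have "sum g (?N v) = sum g ((?H \<union> ?S) \<union> ?M)"
          by simp
        also have "\<dots> = sum g (?H \<union> ?S) + sum g ?M"
          by (rule sum.union_disjoint) (auto simp: finite_nbrs G)
        also have "sum g (?H \<union> ?S) = sum g ?H + sum g ?S"
          by (rule sum.union_disjoint) (auto simp: finite_nbrs G needy_not_big)
        finally show ?thesis .
      qed
      define h where "h = int (card ?H)"
      define m where "m = int (card ?M)"
      define S where "S = sum d ?S"
      have "S \<ge> 0"
        by (auto simp: S_def d_def intro: sum_nonneg)
      have "int (nbr_degree_sum G v) = sum d (?N v)"
        by (simp add: nbr_degree_sum_def d_def)
      also have "\<dots> = sum d ?H + S + sum d ?M"
        by (simp add: split S_def)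
      also have "sum d ?H \<le> h * int D"
        using sum_bounded_above[of ?H d "int D"] max N_V by (auto simp: d_def h_def)
      also have "sum d ?M \<le> m * (8 * c - 3)"
        using sum_bounded_above[of ?M d "8 * c - 3"] by (auto simp: big_def m_def)
      finally have upper: "int (nbr_degree_sum G v) \<le> h * int D + S + m * (8 * c - 3)"
        by simp
      have "h * (8 * c - 2) + S + m * (4 * c) \<ge> 16 * c - 4"
      proof (rule charge_arith[OF c D])
        show "h * int D + S + m * (8 * c - 3) \<ge> 2 * int D"
          using upper strong by linarith
        \<comment> \<open>A needy neighbour is weak, which forces the degree sum at \<open>v\<close>
          strictly above 2D.\<close>
        assume "S > 0"
        then have "?S \<noteq> {}"
          unfolding S_def by (metis sum.empty less_irrefl)
        then obtain u where "adjacent G v u" "nbr_degree_sum G u < 2 * D"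
          by (auto simp: needy_def nbrs_def)
        then have "nbr_degree_sum G v > 2 * D"
          using weak by blast
        then show "h * int D + S + m * (8 * c - 3) \<ge> 2 * int D + 1"
          using upper by linarith
      qed (use \<open>S \<ge> 0\<close> in \<open>auto simp: h_def m_def\<close>)
      also have "h * (8 * c - 2) = (\<Sum>u\<in>?H. 8 * c - 2)"
        by (simp add: h_def)
      also have "m * (4 * c) = (\<Sum>u\<in>?M. 4 * c)"
        by (simp add: m_def)
      also have "(\<Sum>u\<in>?H. 8 * c - 2) + S + (\<Sum>u\<in>?M. 4 * c) \<le> (\<Sum>u\<in>?N v. 4 * c + f u v - f v u)"
        unfolding split S_def
      proof (intro add_mono sum_mono)
        fix u assume "u \<in> ?H"
        then show "8 * c - 2 \<le> 4 * c + f u v - f v u"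
          using not_big needy_not_big[of u] by (auto simp: f_def)
      next
        fix u assume "u \<in> ?S"
        then show "d u \<le> 4 * c + f u v - f v u"
          using not_big strong f_nonneg[of u v] by (auto simp: f_def[of v])
      next
        fix u assume "u \<in> ?M"
        then show "4 * c \<le> 4 * c + f u v - f v u"
          using not_big f_nonneg[of u v] by (auto simp: f_def[of v])
      qed
      finally show ?thesis .
    qed
  qed
  \<comment> \<open>Charge is conserved: the total received equals the total sent.\<close>
  have "(\<Sum>v\<in>?V. \<Sum>u\<in>?N v. f u v) = (\<Sum>v\<in>?V. \<Sum>u\<in>{u \<in> ?V. adjacent G v u}. f u v)"
    by (intro sum.cong refl) (auto simp: nbrs_def dest: adjacentD[OF G])
  also have "\<dots> = (\<Sum>u\<in>?V. \<Sum>v\<in>{v \<in> ?V. adjacent G v u}. f u v)"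
    by (rule sum.swap_restrict) (use finV in auto)
  also have "\<dots> = (\<Sum>u\<in>?V. \<Sum>v\<in>?N u. f u v)"
    by (intro sum.cong refl) (auto simp: nbrs_def adjacent_commute dest: adjacentD[OF G])
  finally have swap: "(\<Sum>v\<in>?V. \<Sum>u\<in>?N v. f u v) = (\<Sum>v\<in>?V. \<Sum>u\<in>?N v. f v u)" .
  have "(16 * c - 4) * int (card ?V) = (\<Sum>v\<in>?V. 16 * c - 4)"
    by simp
  also have "\<dots> \<le> (\<Sum>v\<in>?V. \<Sum>u\<in>?N v. 4 * c + f u v - f v u)"
    by (rule sum_mono) (rule final)
  also have "\<dots> = (\<Sum>v\<in>?V. d v * (4 * c))"
    by (simp add: sum.distrib sum_subtractf swap card_N)
  also have "\<dots> = int (\<Sum>v\<in>?V. degree G v) * (4 * c)"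
    by (simp add: d_def sum_distrib_right)
  finally show ?thesis
    by (simp add: sum_degree[OF G] algebra_simps)
qed

section \<open>The square of a sparse graph\<close>

text \<open>\<open>D\<close> is a fixed bound, since deletions may lower the maximum degree while
  the lists stay the same. Sparsity is required of all subgraphs, so it is inherited in the
  induction.\<close>

lemma sq_colors_sparse:
  fixes c :: int and D :: nat
  assumes c: "c \<ge> 2" and D: "int D \<ge> 14 * c - 7"
    and "finite_simple_graph G"
    and "\<And>v. v \<in> verts G \<Longrightarrow> degree G v \<le> D"
    and "\<And>H. subgraph H G \<Longrightarrow> verts H \<noteq> {} \<Longrightarrow>
           c * (2 * int (card (edges H))) < (4 * c - 1) * int (card (verts H))"
    and "\<And>v. v \<in> verts G \<Longrightarrow> card (L v) \<ge> 2 * D"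
  shows "\<exists>\<phi>. sq_colors G L (verts G) \<phi>"
  using assms(3-)
proof (induction "card (verts G) + card (edges G)" arbitrary: G rule: less_induct)
  case less
  note G = less.prems(1) and max = less.prems(2) and sparse = less.prems(3)
    and lists = less.prems(4)
  have finV: "finite (verts G)" and finE: "finite (edges G)"
    using G finite_edges by (auto simp: finite_simple_graph_def)
  have "D > 0"
    using c D by linarith
  have IH: "\<exists>\<phi>. sq_colors H L (verts H) \<phi>"
    if H: "subgraph H G" and "card (verts H) + card (edges H) < card (verts G) + card (edges G)" for H
  proof (rule less.hyps)
    show "finite_simple_graph H"
      using H by (simp add: subgraph_def)
    fix v assume "v \<in> verts H"
    then have "v \<in> verts G"
      using H by (auto simp: subgraph_def)
    then show "degree H v \<le> D" "card (L v) \<ge> 2 * D"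
      using max lists degree_subgraph_le[OF H G, of v] by (blast intro: order_trans)+
  next
    fix K assume "subgraph K H" "verts K \<noteq> {}"
    then show "c * (2 * int (card (edges K))) < (4 * c - 1) * int (card (verts K))"
      using sparse subgraph_trans[OF _ H] by blast
  qed (rule that(2))
  show ?case
  proof (rule ccontr)
    assume contra: "\<not> ?case"
    have min: "degree G v \<ge> 2" if v: "v \<in> verts G" for v
    proof (rule ccontr)
      assume "\<not> degree G v \<ge> 2"
      then have deg: "degree G v \<le> 1"
        by simp
      let ?H = "delete_vertex G v"
      have "card (verts ?H) < card (verts G)"
        unfolding delete_vertex_def using card_Diff1_less[OF finV v] by simp
      moreover have "card (edges ?H) \<le> card (edges G)"
        using finE by (auto simp: delete_vertex_def intro: card_mono)
      ultimately obtain \<phi> where \<phi>: "sq_colors ?H L (verts ?H) \<phi>"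
        using IH[OF subgraph_delete_vertex[OF G, of v]] by auto
      \<comment> \<open>With at most one neighbour the degree sum is at most D, which is below 2D
        because D > 0.\<close>
      have "nbr_degree_sum G v \<le> card (nbrs G v) * D"
        unfolding nbr_degree_sum_def
        using sum_bounded_above[of "nbrs G v" "degree G" D] max nbrs_subset[OF G] by auto
      also have "\<dots> \<le> 1 * D"
        using deg by (intro mult_right_mono) (auto simp: card_nbrs[OF G])
      also have "\<dots> < card (L v)"
        using lists[OF v] \<open>D > 0\<close> by linarith
      finally show False
        using sq_colors_extend_pendant[OF G v deg _ \<phi>] contra by blast
    qed
    have weak: "nbr_degree_sum G u > 2 * D"
      if uv: "adjacent G u v" and v: "nbr_degree_sum G v < 2 * D" for u v
    proof (rule ccontr)
      assume u: "\<not> nbr_degree_sum G u > 2 * D"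
      let ?H = "delete_edge G {u, v}"
      have "card (edges ?H) < card (edges G)"
        using uv card_Diff1_less[OF finE] by (simp only: delete_edge_def adjacent_def graph.simps)
      moreover have "verts ?H = verts G"
        by (simp add: delete_edge_def)
      ultimately obtain \<phi> where \<phi>: "sq_colors ?H L (verts ?H) \<phi>"
        using IH[OF subgraph_delete_edge[OF G, of "{u, v}"]] by auto
      have "nbr_degree_sum G u \<le> card (L u)" "nbr_degree_sum G v < card (L v)"
        using u v lists adjacentD[OF G uv] by fastforce+
      then show False
        using sq_colors_extend_edge[OF G uv _ _ \<phi>] contra by blast
    qed
    \<comment> \<open>The empty graph is colored trivially, so \<open>sparse\<close> may be applied
      to \<open>G\<close> itself and contradicts \<open>discharging\<close>.\<close>
    have "verts G \<noteq> {}"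
      using contra by (auto simp: sq_colors_def)
    then have "c * (2 * int (card (edges G))) < (4 * c - 1) * int (card (verts G))"
      using sparse G by (simp add: subgraph_def)
    moreover have "c * (2 * int (card (edges G))) \<ge> (4 * c - 1) * int (card (verts G))"
      by (rule discharging[OF c D G max min weak])
    ultimately show False
      by simp
  qed
qed

section \<open>From \<open>mad\<close> and \<open>distance\<close> to edge counts and
  \<open>sq_nbrs\<close>\<close>

lemma average_degree_le_mad:
  assumes "finite_simple_graph G" "subgraph H G" "verts H \<noteq> {}"
  shows "average_degree H \<le> mad G"
proof -
  let ?A = "{average_degree H | H. subgraph H G \<and> verts H \<noteq> {}}"
  \<comment> \<open>\<open>Max\<close> is meaningful only on a finite set; subgraphs are given by
    pairs of subsets of two finite sets.\<close>
  have "?A \<subseteq> (\<lambda>(V, E). average_degree \<lparr>verts = V, edges = E\<rparr>) ` (Pow (verts G) \<times> Pow (edges G))"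
  proof
    fix a assume "a \<in> ?A"
    then obtain K where K: "a = average_degree K" "subgraph K G"
      by blast
    then show "a \<in> (\<lambda>(V, E). average_degree \<lparr>verts = V, edges = E\<rparr>) ` (Pow (verts G) \<times> Pow (edges G))"
      by (cases K) (auto simp: subgraph_def intro!: image_eqI[of _ _ "(verts K, edges K)"])
  qed
  moreover have "finite (Pow (verts G) \<times> Pow (edges G))"
    using assms(1) finite_edges by (auto simp: finite_simple_graph_def)
  ultimately have "finite ?A"
    by (meson finite_imageI finite_subset)
  then show ?thesis
    unfolding mad_def using assms by (intro Max_ge) auto
qed

lemma square_adjacent_imp_sq_nbrs:
  assumes "adjacent (square G) u v"
  shows "v \<in> sq_nbrs G u"
proof -
  have "v \<in> sq_nbrs G u" if "u \<noteq> v" "distance G u v \<le> 2" for u v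
  proof -
    let ?A = "{enat (length p - 1) | p. path_between G u p v}"
    have "Inf ?A \<le> 2"
      using that by (simp add: distance_def)
    \<comment> \<open>Without a path the infimum would be infinite. A nonempty set in the well-order
      \<open>enat\<close> attains its infimum, so some path has at most 3 vertices.\<close>
    have "?A \<noteq> {}"
    proof
      assume "?A = {}"
      with \<open>Inf ?A \<le> 2\<close> have "Inf {} \<le> (2 :: enat)"
        by simp
      then show False
        by (simp add: top_enat_def)
    qed
    then have "Inf ?A \<in> ?A"
      by (metis (no_types, lifting) ex_in_conv wellorder_InfI)
    then obtain p where p: "path_between G u p v" and "enat (length p - 1) \<le> 2"
      using \<open>Inf ?A \<le> 2\<close> by auto
    then have len: "length p \<le> 3"
      by (simp add: numeral_eq_enat)
    from p \<open>u \<noteq> v\<close> obtain q where q: "p = u # q" "q \<noteq> []"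
      by (cases p) (auto simp: path_between_def split: if_splits)
    then obtain w r where r: "q = w # r"
      by (cases q) auto
    consider "r = []" | z where "r = [z]"
      using len q r by (cases r) auto
    then show ?thesis
      using p q r \<open>u \<noteq> v\<close> by cases (auto simp: path_between_def sq_nbrs_def)
  qed
  then show ?thesis
    using assms sq_nbrs_commute[of u G v]
    by (auto simp: adjacent_def square_def doubleton_eq_iff)
qed

theorem theorem1p4:
  fixes G :: "'a graph" and c :: int
  assumes "c \<ge> 2"
    and "finite_simple_graph G"
    and "mad G < 4 - 1 / real_of_int c"
    and "int (max_degree G) \<ge> 14 * c - 7"
  shows "list_chromatic_number (square G) \<le> 2 * max_degree G"
proof -
  have max: "degree G v \<le> max_degree G" if "v \<in> verts G" for v
    using that assms(2) unfolding max_degree_def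
    by (intro Max_ge) (auto simp: finite_simple_graph_def)
  have sparse: "c * (2 * int (card (edges H))) < (4 * c - 1) * int (card (verts H))"
    if H: "subgraph H G" "verts H \<noteq> {}" for H
  proof -
    have "finite (verts H)"
      using H by (simp add: subgraph_def finite_simple_graph_def)
    then have pos: "real (card (verts H)) > 0"
      using H by (simp add: card_gt_0_iff)
    have "2 * real (card (edges H)) / real (card (verts H)) < 4 - 1 / real_of_int c"
      using average_degree_le_mad[OF assms(2) H] assms(3) by (simp add: average_degree_def)
    then have "2 * real (card (edges H)) < (4 - 1 / real_of_int c) * real (card (verts H))"
      using pos by (simp add: pos_divide_less_eq)
    \<comment> \<open>Multiplying by c > 0 clears 1/c, so the inequality can be read over the
      integers.\<close>
    then have "real_of_int c * (2 * real (card (edges H)))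
        < real_of_int c * ((4 - 1 / real_of_int c) * real (card (verts H)))"
      using assms(1) by (intro mult_strict_left_mono) auto
    also have "\<dots> = (4 * real_of_int c - 1) * real (card (verts H))"
      using assms(1) by (simp add: field_simps)
    finally have "real_of_int (c * (2 * int (card (edges H))))
        < real_of_int ((4 * c - 1) * int (card (verts H)))"
      by simp
    then show ?thesis
      by (simp only: of_int_less_iff)
  qed
  have "choosable (square G) (2 * max_degree G)"
    unfolding choosable_def
  proof (intro allI impI)
    fix L :: "'a \<Rightarrow> nat set"
    assume L: "\<forall>v\<in>verts (square G). finite (L v) \<and> 2 * max_degree G \<le> card (L v)"
    have V: "verts (square G) = verts G"
      by (simp add: square_def)
    obtain \<phi> where "sq_colors G L (verts G) \<phi>"
      using sq_colors_sparse[OF assms(1,4,2) max sparse] L V by blast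
    then show "\<exists>\<phi>. proper_coloring (square G) \<phi> \<and> (\<forall>v\<in>verts (square G). \<phi> v \<in> L v)"
      unfolding sq_colors_def proper_coloring_def V
      by (meson square_adjacent_imp_sq_nbrs)
  qed
  then show ?thesis
    unfolding list_chromatic_number_def by (rule Least_le)
qed

end
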